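(* Let $p:\mathbb{R}^n\to\mathbb{R}$ be a convex SPQ polynomial. Then the Hessian of $p$ can be written as the sum of positive semidefinite univariate polynomial matrices. In particular, an SPQ polynomial is convex if and only if it is sos-convex.
   Context: All polynomials have real coefficients. A polynomial $p:\mathbb{R}^n\to\mathbb{R}$ is separable plus quadratic (SPQ) if $p(x)=s(x)+q(x)$, where $s(x)=\sum_{i=1}^n s_i(x_i)$ for some univariate polynomials $s_i$ and $q(x)$ is a quadratic polynomial (degree at most $2$). A polynomial matrix is a matrix whose entries are polynomials in $x=(x_1,\dots,x_n)$; it is called univariate if all its entries are polynomials in one and the same single variable $x_i$ (different matrices in a sum may involve different variables; constant matrices are allowed). A symmetric polynomial matrix $P(x)$ is positive semidefinite if $P(x)$ is a positive semidefinite matrix for every $x\in\mathbb{R}^n$. A symmetric $m\times m$ polynomial matrix $P(x)$ is an sos-matrix if $P(x)=A(x)^TA(x)$ for some (not necessarily square) polynomial matrix $A(x)$; equivalently, if the scalar polynomial $y^TP(x)y$ in the variables $(x,y)$, $y\in\mathbb{R}^m$, is a sum of squares of polynomials. A polynomial is sos-convex if its Hessian is an sos-matrix. *)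

theory Defs
  imports "HOL-Analysis.Analysis" "HOL-Computational_Algebra.Polynomial"
begin

text \<open>
  Polynomials in $n$ real variables are represented by the functions they induce on
  \<^typ>\<open>real ^ 'n\<close> (no information is lost, as the reals are infinite); the library predicate
  \<^const>\<open>real_polynomial_function\<close> singles them out. Polynomial matrices are
  matrix-valued functions.
\<close>

definition quadratic :: "(real ^ 'n \<Rightarrow> real) \<Rightarrow> bool" where
  "quadratic q \<longleftrightarrow> (\<exists>(A :: real ^ 'n ^ 'n) (b :: real ^ 'n) (c :: real).
     \<forall>x. q x = x \<bullet> (A *v x) + b \<bullet> x + c)"

definition separable :: "(real ^ 'n \<Rightarrow> real) \<Rightarrow> bool" where
  "separable s \<longleftrightarrow> (\<exists>u :: 'n \<Rightarrow> real poly. \<forall>x. s x = (\<Sum>i\<in>UNIV. poly (u i) (x $ i)))"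

definition spq :: "(real ^ 'n \<Rightarrow> real) \<Rightarrow> bool" where
  "spq p \<longleftrightarrow> (\<exists>s q. separable s \<and> quadratic q \<and> (\<forall>x. p x = s x + q x))"

definition partial_deriv :: "'n \<Rightarrow> (real ^ 'n \<Rightarrow> real) \<Rightarrow> real ^ 'n \<Rightarrow> real" where
  "partial_deriv i f x = deriv (\<lambda>t. f (x + t *\<^sub>R axis i 1)) 0"

definition hessian :: "(real ^ 'n \<Rightarrow> real) \<Rightarrow> real ^ 'n \<Rightarrow> real ^ 'n ^ 'n" where
  "hessian f x = (\<chi> i j. partial_deriv i (partial_deriv j f) x)"

definition pos_semidef :: "real ^ 'm ^ 'm \<Rightarrow> bool" where
  "pos_semidef M \<longleftrightarrow> transpose M = M \<and> (\<forall>v. 0 \<le> v \<bullet> (M *v v))"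

definition psd_matrix_function :: "(real ^ 'n \<Rightarrow> real ^ 'm ^ 'm) \<Rightarrow> bool" where
  "psd_matrix_function P \<longleftrightarrow> (\<forall>x. pos_semidef (P x))"

text \<open>The variable \<open>i\<close> is shared by all entries of the matrix.\<close>

definition univariate_polynomial_matrix :: "(real ^ 'n \<Rightarrow> real ^ 'k ^ 'm) \<Rightarrow> bool" where
  "univariate_polynomial_matrix P \<longleftrightarrow>
     (\<exists>i. \<forall>a b. \<exists>u :: real poly. \<forall>x. P x $ a $ b = poly u (x $ i))"

text \<open>
  The factor \<open>A\<close> in $P = A^T A$ has an arbitrary number \<open>r\<close> of rows; since \<open>r\<close> is quantified
  inside the formula it cannot be a type, so \<open>A k x\<close> is the \<open>k\<close>-th row of $A(x)$ for \<open>k < r\<close>.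
\<close>

definition sos_matrix :: "(real ^ 'n \<Rightarrow> real ^ 'm ^ 'm) \<Rightarrow> bool" where
  "sos_matrix P \<longleftrightarrow>
     (\<exists>(r :: nat) (A :: nat \<Rightarrow> real ^ 'n \<Rightarrow> real ^ 'm).
        (\<forall>k<r. \<forall>a. real_polynomial_function (\<lambda>x. A k x $ a)) \<and>
        (\<forall>x a b. P x $ a $ b = (\<Sum>k<r. A k x $ a * A k x $ b)))"

definition sos_convex :: "(real ^ 'n \<Rightarrow> real) \<Rightarrow> bool" where
  "sos_convex p \<longleftrightarrow> real_polynomial_function p \<and> sos_matrix (hessian p)"

end

theory Submission
  imports Defs "HOL-Computational_Algebra.Fundamental_Theorem_Algebra"
begin

text \<open>
  The Hessian of $p = \sum_i u_i(x_i) + x^T A x + b^T x + c$ is the diagonal matrix of the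
  $u_i''(x_i)$ plus the constant matrix $B = A + A^T$. If it is positive semidefinite everywhere,
  then its diagonal entries are nonnegative, so each $u_i''$ is bounded below and attains its
  minimum at some $a_i$. Hence the Hessian is its value at the point $a$ plus the diagonal matrix
  of the nonnegative univariate polynomials $u_i'' - u_i''(a_i)$. Finally, a constant positive
  semidefinite matrix is a Gram matrix, and a nonnegative univariate polynomial is a sum of squares.
\<close>

text \<open>Serves to stack the rows of two factors when sos-matrices are added.\<close>

lemma sum_lessThan_concat:
  fixes f g :: "nat \<Rightarrow> 'a::comm_monoid_add"
  shows "(\<Sum>k<r + s. if k < r then f k else g (k - r)) = (\<Sum>k<r. f k) + (\<Sum>k<s. g k)"
  by (induction s) (simp_all add: add.assoc)

section \<open>Minima and sums of squares of univariate polynomials\<close>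

text \<open>A nonconstant polynomial is large in absolute value far out, and the lower bound
  excludes large negative values. So a minimum over a compact interval is global.\<close>

lemma real_poly_bounded_below_attains_min:
  fixes f :: "real poly"
  assumes "\<And>x. c \<le> poly f x"
  obtains a where "\<And>x. poly f a \<le> poly f x"
proof (cases "degree f = 0")
  case True
  then show ?thesis using that by (metis degree_eq_zeroE order_refl poly_const_conv)
next
  case False
  obtain b q where f: "f = pCons b q" by (cases f)
  then have "q \<noteq> 0" using False by auto
  \<comment> \<open>A negative value of \<open>f\<close> has absolute value at most
    \<open>\<bar>c\<bar>\<close>. Beyond this threshold \<open>f\<close> is therefore positive and
    exceeds \<open>poly f 0\<close>.\<close>
  from poly_infinity[OF this, of "\<bar>c\<bar> + \<bar>poly f 0\<bar> + 1" b]
  obtain r where r: "\<And>z. r \<le> \<bar>z\<bar> \<Longrightarrow> \<bar>c\<bar> + \<bar>poly f 0\<bar> + 1 \<le> \<bar>poly f z\<bar>"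
    unfolding f by auto
  \<comment> \<open>The absolute value makes the interval contain 0 even if \<open>r\<close> is
    negative.\<close>
  have "continuous_on {- \<bar>r\<bar>..\<bar>r\<bar>} (poly f)" by (intro continuous_intros)
  then have "\<exists>a\<in>{- \<bar>r\<bar>..\<bar>r\<bar>}. \<forall>x\<in>{- \<bar>r\<bar>..\<bar>r\<bar>}. poly f a \<le> poly f x"
    by (intro continuous_attains_inf) auto
  then obtain a where a: "\<And>x. x \<in> {- \<bar>r\<bar>..\<bar>r\<bar>} \<Longrightarrow> poly f a \<le> poly f x" by blast
  have "poly f a \<le> poly f x" for x
  proof (cases "r \<le> \<bar>x\<bar>")
    case True
    then have "poly f 0 \<le> poly f x" using r[of x] assms[of x] by linarith
    moreover have "poly f a \<le> poly f 0" by (rule a) auto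
    ultimately show ?thesis by linarith
  next
    case False
    then show ?thesis by (intro a) auto
  qed
  then show ?thesis using that by blast
qed

lemma real_poly_nonneg_imp_sum_of_squares:
  fixes f :: "real poly"
  assumes "\<And>x. 0 \<le> poly f x"
  shows "\<exists>(r::nat) g. f = (\<Sum>k<r. (g k)\<^sup>2)"
  using assms
\<comment> \<open>If \<open>f\<close> has its minimum \<open>m\<close> at \<open>a\<close>, then \<open>f - m\<close> vanishes to second order at \<open>a\<close>, so
  \<open>f = m + (x - a)\<^sup>2 g\<close> with \<open>g\<close> nonnegative of smaller degree.\<close>
proof (induction "degree f" arbitrary: f rule: less_induct)
  case less
  obtain a where a: "\<And>x. poly f a \<le> poly f x"
    using real_poly_bounded_below_attains_min[OF less.prems] by blast
  define m where "m = poly f a"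
  have "m \<ge> 0" using less.prems m_def by simp
  define F where "F = f - [:m:]"
  have "poly F a = 0" by (simp add: F_def m_def)
  then obtain h where h: "F = [:-a, 1:] * h" by (auto simp: poly_eq_0_iff_dvd)
  have F0: "poly F x \<ge> 0" for x using a by (simp add: F_def m_def)
  have "poly (pderiv F) a = 0"
    by (rule DERIV_local_min[OF poly_DERIV, of 1]) (use F0 \<open>poly F a = 0\<close> in auto)
  \<comment> \<open>By the product rule the derivative of \<open>F\<close> at \<open>a\<close> is
    \<open>poly h a\<close>.\<close>
  then have "poly h a = 0" unfolding h pderiv_mult by (simp add: pderiv_pCons)
  then obtain g where g: "h = [:-a, 1:] * g" by (auto simp: poly_eq_0_iff_dvd)
  have f: "f = [:sqrt m:]\<^sup>2 + [:-a, 1:]\<^sup>2 * g"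
  proof -
    have "[:-a, 1:]\<^sup>2 * g = F" by (simp only: h g power2_eq_square mult.assoc)
    then show ?thesis using \<open>m \<ge> 0\<close> by (simp add: F_def power2_eq_square)
  qed
  show ?case
  proof (cases "g = 0")
    case True
    then have "f = (\<Sum>k<Suc 0. [:sqrt m:]\<^sup>2)" using f by simp
    then show ?thesis by (intro exI[of _ "Suc 0"] exI[of _ "\<lambda>_. [:sqrt m:]"])
  next
    case False
    have off: "poly g x \<ge> 0" if "x \<noteq> a" for x
    proof -
      have "0 \<le> (x - a)\<^sup>2 * poly g x"
        using F0[of x] by (simp add: h g power2_eq_square algebra_simps)
      then show ?thesis using that by (simp add: zero_le_mult_iff)
    qed
    \<comment> \<open>Dividing by \<open>(x - a)\<^sup>2\<close> says nothing at \<open>a\<close>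
      itself; continuity carries the sign over.\<close>
    have "poly g a \<ge> 0"
    proof (rule tendsto_lowerbound)
      show "(poly g \<longlongrightarrow> poly g a) (at a)" using poly_isCont isCont_def by blast
      show "\<forall>\<^sub>F x in at a. 0 \<le> poly g x"
        using off by (auto simp: eventually_at_filter)
    qed simp
    with off have g0: "\<And>x. poly g x \<ge> 0" by metis
    \<comment> \<open>Stated for an abstract \<open>l\<close>, so that simplification does not
      expand the product with \<open>[:-a, 1:]\<close>.\<close>
    have "degree (l * (l * g)) = degree g + 2" if "degree l = 1" for l
      using that False by (cases "l = 0") (auto simp: degree_mult_eq)
    from this[of "[:-a, 1:]"] have "degree F = degree g + 2"
      unfolding h g by (simp del: mult_pCons_left)
    moreover have "degree F \<le> degree f"
      unfolding F_def by (rule degree_diff_le) auto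
    ultimately have "degree g < degree f" by simp
    from less.hyps[OF this g0] obtain r :: nat and w where w: "g = (\<Sum>k<r. (w k)\<^sup>2)" by blast
    define l where "l = [:-a, 1:]"
    \<comment> \<open>The factor \<open>l\<close> is absorbed into each square of \<open>g\<close>;
      index \<open>r\<close> holds the square that accounts for the minimum
      \<open>m\<close>.\<close>
    define W where "W k = (if k < r then l * w k else [:sqrt m:])" for k
    have "(\<Sum>k<r. (W k)\<^sup>2) = l\<^sup>2 * g"
      unfolding w sum_distrib_left by (rule sum.cong) (simp_all add: W_def power_mult_distrib)
    moreover have "W r = [:sqrt m:]" by (simp add: W_def)
    ultimately have "(\<Sum>k<Suc r. (W k)\<^sup>2) = l\<^sup>2 * g + [:sqrt m:]\<^sup>2"
      by (simp only: sum.lessThan_Suc)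
    also have "\<dots> = f" unfolding f l_def by (rule add.commute)
    finally show ?thesis by (intro exI[of _ "Suc r"] exI[of _ W]) (rule sym)
  qed
qed

section \<open>Gram factorization of constant positive semidefinite matrices\<close>

lemma pos_semidef_sym: "pos_semidef M \<Longrightarrow> M $ i $ j = M $ j $ i"
  unfolding pos_semidef_def by (drule conjunct1, drule arg_cong[of _ _ "\<lambda>N. N $ j $ i"])
    (simp add: transpose_def)

lemma mult_axis_component:
  fixes M :: "real ^ 'n ^ 'm"
  shows "(M *v axis j 1) $ i = M $ i $ j"
  by (simp add: matrix_vector_mult_basis column_def)

lemma axis_inner_mult_axis:
  fixes M :: "real ^ 'n ^ 'n"
  shows "axis i 1 \<bullet> (M *v axis j 1) = M $ i $ j"
  by (simp add: inner_axis' mult_axis_component)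

lemma pos_semidef_diag_nonneg: "pos_semidef M \<Longrightarrow> 0 \<le> M $ i $ i"
  by (metis axis_inner_mult_axis pos_semidef_def)

lemma quadratic_form_shift:
  fixes M :: "real ^ 'n ^ 'n"
  assumes "transpose M = M"
  shows "(v + t *\<^sub>R axis a 1) \<bullet> (M *v (v + t *\<^sub>R axis a 1)) =
    v \<bullet> (M *v v) + 2 * t * (M *v v) $ a + t\<^sup>2 * M $ a $ a"
proof -
  have "v \<bullet> (M *v axis a 1) = (M *v v) $ a"
    by (metis assms dot_lmul_matrix inner_axis inner_commute real_inner_1_right vector_transpose_matrix)
  then show ?thesis
    by (simp add: matrix_vector_right_distrib matrix_vector_mult_scaleR inner_add_left inner_add_right
        mult_axis_component inner_axis' power2_eq_square algebra_simps)
qed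

text \<open>With a vanishing diagonal entry the form is affine in \<open>t\<close> along
  \<open>axis j 1 + t *\<^sub>R axis a 1\<close>, and an affine function bounded below has slope
  zero.\<close>

lemma pos_semidef_zero_row:
  assumes M: "pos_semidef M" and "M $ a $ a = 0"
  shows "M $ a $ j = 0"
proof (rule ccontr)
  assume nz: "M $ a $ j \<noteq> 0"
  \<comment> \<open>Solves \<open>M $ j $ j + 2 * t * M $ a $ j = -1\<close>.\<close>
  define t where "t = - (M $ j $ j + 1) / (2 * M $ a $ j)"
  have "0 \<le> (axis j 1 + t *\<^sub>R axis a 1) \<bullet> (M *v (axis j 1 + t *\<^sub>R axis a 1))"
    using M by (simp add: pos_semidef_def)
  also have "\<dots> = M $ j $ j + 2 * t * M $ a $ j"
    using M assms(2) by (subst quadratic_form_shift)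
      (simp_all add: pos_semidef_def axis_inner_mult_axis mult_axis_component)
  also have "\<dots> = -1" using nz by (simp add: t_def field_simps)
  finally show False by simp
qed

text \<open>The form of the Schur complement at \<open>v\<close> is the minimum over
  \<open>t\<close> of the form of \<open>M\<close> at \<open>v + t *\<^sub>R axis a 1\<close>, hence
  nonnegative.\<close>

lemma pos_semidef_schur_complement:
  assumes M: "pos_semidef M" and pos: "M $ a $ a > 0"
  shows "pos_semidef (\<chi> i j. M $ i $ j - M $ i $ a * M $ a $ j / M $ a $ a)" (is "pos_semidef ?N")
  unfolding pos_semidef_def
proof (intro conjI allI)
  have "?N $ j $ i = ?N $ i $ j" for i j
    using pos_semidef_sym[OF M, of i j] pos_semidef_sym[OF M, of i a] pos_semidef_sym[OF M, of a j]
    by simp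
  then show "transpose ?N = ?N" by (simp add: transpose_def vec_eq_iff)
  fix v
  \<comment> \<open>The minimizer of the quadratic in \<open>t\<close> from
    \<open>quadratic_form_shift\<close>.\<close>
  let ?t = "- ((M *v v) $ a / M $ a $ a)"
  have sym: "transpose M = M" using M by (simp add: pos_semidef_def)
  have "(?N *v v) $ i = (M *v v + ?t *\<^sub>R (M *v axis a 1)) $ i" for i
    by (simp add: mult_axis_component)
      (simp add: matrix_vector_mult_def sum_subtractf sum_distrib_left sum_divide_distrib algebra_simps)
  then have "?N *v v = M *v v + ?t *\<^sub>R (M *v axis a 1)" by (simp add: vec_eq_iff)
  moreover have "v \<bullet> (M *v axis a 1) = (M *v v) $ a"
    by (metis sym dot_lmul_matrix inner_axis inner_commute real_inner_1_right vector_transpose_matrix)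
  ultimately have "v \<bullet> (?N *v v) = v \<bullet> (M *v v) + ?t * (M *v v) $ a"
    by (simp add: inner_diff_right)
  also have "\<dots> = (v + ?t *\<^sub>R axis a 1) \<bullet> (M *v (v + ?t *\<^sub>R axis a 1))"
    using pos by (subst quadratic_form_shift[OF sym]) (simp add: field_simps power2_eq_square)
  also have "\<dots> \<ge> 0" using M by (simp add: pos_semidef_def)
  finally show "0 \<le> v \<bullet> (?N *v v)" .
qed

lemma pos_semidef_imp_gram:
  fixes M :: "real ^ 'n ^ 'n"
  assumes "pos_semidef M"
  shows "\<exists>(r::nat) B. \<forall>i j. M $ i $ j = (\<Sum>k<r. B k i * B k j)"
proof -
  \<comment> \<open>Cholesky elimination, by induction on a set \<open>S\<close> of indices that supports \<open>M\<close>\<close>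
  have "\<exists>(r::nat) B. \<forall>i j. M $ i $ j = (\<Sum>k<r. B k i * B k j)"
    if "finite S" "pos_semidef M" "\<And>i j. i \<notin> S \<Longrightarrow> M $ i $ j = 0" for S and M :: "real ^ 'n ^ 'n"
    using that
  proof (induction S arbitrary: M)
    case empty
    then show ?case by (intro exI[of _ 0]) simp
  next
    case (insert a S)
    show ?case
    proof (cases "M $ a $ a = 0")
      case True
      \<comment> \<open>Row \<open>a\<close> vanishes as well, so \<open>S\<close> already supports
        \<open>M\<close> and nothing has to be eliminated.\<close>
      with insert.prems have "\<And>i j. i \<notin> S \<Longrightarrow> M $ i $ j = 0"
        by (metis insert_iff pos_semidef_zero_row)
      with insert show ?thesis by blast
    next
      case False
      with pos_semidef_diag_nonneg[OF insert.prems(1), of a] have pos: "M $ a $ a > 0" by simp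
      let ?N = "\<chi> i j. M $ i $ j - M $ i $ a * M $ a $ j / M $ a $ a"
      \<comment> \<open>Elimination clears row \<open>a\<close> and leaves the zero rows
        zero.\<close>
      have "?N $ i $ j = 0" if "i \<notin> S" for i j
        using that pos insert.prems(2)[of i] by (cases "i = a") auto
      from insert.IH[OF pos_semidef_schur_complement[OF insert.prems(1) pos] this]
      obtain r :: nat and B where B: "\<And>i j. ?N $ i $ j = (\<Sum>k<r. B k i * B k j)" by blast
      \<comment> \<open>The extra row at index \<open>r\<close> restores the rank-one matrix that
        was subtracted, using the symmetry of \<open>M\<close>.\<close>
      define C where "C k i = (if k < r then B k i else M $ i $ a / sqrt (M $ a $ a))" for k i
      have "M $ i $ j = (\<Sum>k<Suc r. C k i * C k j)" for i j
        using B[of i j] pos pos_semidef_sym[OF insert.prems(1), of j a]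
        by (simp add: C_def algebra_simps)
      then show ?thesis by blast
    qed
  qed
  from this[OF finite[of UNIV] assms] show ?thesis by simp
qed

section \<open>Closure properties and examples of sos-matrices\<close>

lemma sos_matrix_0: "sos_matrix (\<lambda>x. 0)"
  unfolding sos_matrix_def by (intro exI[of _ 0]) simp

text \<open>Stacking the factors \<open>A\<close> and \<open>B\<close> on top of each other adds
  their Gram matrices.\<close>

lemma sos_matrix_add:
  assumes "sos_matrix P" "sos_matrix Q"
  shows "sos_matrix (\<lambda>x. P x + Q x)"
proof -
  obtain r :: nat and A where A: "\<And>k a. k < r \<Longrightarrow> real_polynomial_function (\<lambda>x. A k x $ a)"
    "\<And>x a b. P x $ a $ b = (\<Sum>k<r. A k x $ a * A k x $ b)"
    using assms(1) unfolding sos_matrix_def by blast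
  obtain s :: nat and B where B: "\<And>k a. k < s \<Longrightarrow> real_polynomial_function (\<lambda>x. B k x $ a)"
    "\<And>x a b. Q x $ a $ b = (\<Sum>k<s. B k x $ a * B k x $ b)"
    using assms(2) unfolding sos_matrix_def by blast
  define C where "C k = (if k < r then A k else B (k - r))" for k
  have "real_polynomial_function (\<lambda>x. C k x $ a)" if "k < r + s" for k a
    using A(1)[of k a] B(1)[of "k - r" a] that by (auto simp: C_def)
  moreover have "(P x + Q x) $ a $ b = (\<Sum>k<r + s. C k x $ a * C k x $ b)" for x a b
    using sum_lessThan_concat[where r = r and s = s and f = "\<lambda>k. A k x $ a * A k x $ b"
        and g = "\<lambda>k. B k x $ a * B k x $ b"]
    by (simp add: A(2) B(2) C_def if_distrib if_distribR cong: if_cong)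
  ultimately show ?thesis unfolding sos_matrix_def by blast
qed

lemma sos_matrix_sum:
  "finite I \<Longrightarrow> (\<And>i. i \<in> I \<Longrightarrow> sos_matrix (P i)) \<Longrightarrow> sos_matrix (\<lambda>x. \<Sum>i\<in>I. P i x)"
  by (induction I rule: finite_induct) (simp_all add: sos_matrix_0 sos_matrix_add)

lemma sos_matrix_const: "pos_semidef M \<Longrightarrow> sos_matrix (\<lambda>x. M)"
proof -
  assume "pos_semidef M"
  from pos_semidef_imp_gram[OF this]
  obtain r :: nat and B where "\<And>i j. M $ i $ j = (\<Sum>k<r. B k i * B k j)" by blast
  then show ?thesis unfolding sos_matrix_def
    by (intro exI[of _ r] exI[of _ "\<lambda>k x. \<chi> i. B k i"]) auto
qed

lemma real_polynomial_function_poly_component: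
  "real_polynomial_function (\<lambda>x :: real ^ 'n. poly u (x $ i))"
proof (induction u)
  case (pCons a u)
  have "real_polynomial_function (\<lambda>x :: real ^ 'n. x $ i)"
    by (intro real_polynomial_function.intros(1) bounded_linear_vec_nth)
  with pCons show ?case by (auto intro: real_polynomial_function.intros)
qed (auto intro: real_polynomial_function.intros)

text \<open>A multiple of a diagonal matrix unit. A diagonal matrix is a sum of these, one for each
  variable, which is what makes the summands of the Hessian univariate.\<close>

definition single_entry :: "'n \<Rightarrow> real \<Rightarrow> real ^ 'n ^ 'n" where
  "single_entry i c = (\<chi> a b. if a = i \<and> b = i then c else 0)"

lemma single_entry_quadratic_form: "v \<bullet> (single_entry i c *v v) = c * (v $ i)\<^sup>2"
proof -
  have *: "(single_entry i c *v v) $ a = (if a = i then c * v $ i else 0)" for a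
    by (auto simp: single_entry_def matrix_vector_mult_def if_distribR if_distrib cong: if_cong)
  show ?thesis
    by (simp add: inner_vec_def * power2_eq_square if_distrib cong: if_cong)
qed

lemma pos_semidef_single_entry: "0 \<le> c \<Longrightarrow> pos_semidef (single_entry i c)"
  unfolding pos_semidef_def single_entry_quadratic_form
  by (auto simp: transpose_def vec_eq_iff single_entry_def)

lemma univariate_polynomial_matrix_single_entry:
  "univariate_polynomial_matrix (\<lambda>x. single_entry i (poly u (x $ i)))"
  unfolding univariate_polynomial_matrix_def
proof (intro exI[of _ i] allI)
  fix a b
  show "\<exists>w. \<forall>x. single_entry i (poly u (x $ i)) $ a $ b = poly w (x $ i)"
    by (intro exI[of _ "if a = i \<and> b = i then u else 0"]) (auto simp: single_entry_def)
qed

lemma univariate_polynomial_matrix_const: "univariate_polynomial_matrix (\<lambda>x. M)"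
  unfolding univariate_polynomial_matrix_def by (metis poly_const_conv)

lemma sos_matrix_single_entry:
  fixes i :: "'n::finite"
  assumes "\<And>t. 0 \<le> poly u t"
  shows "sos_matrix (\<lambda>x. single_entry i (poly u (x $ i)))"
proof -
  obtain r :: nat and g where g: "u = (\<Sum>k<r. (g k)\<^sup>2)"
    using real_poly_nonneg_imp_sum_of_squares[OF assms] by blast
  \<comment> \<open>Each square in \<open>u\<close> gives one row, supported at coordinate
    \<open>i\<close>.\<close>
  define A :: "nat \<Rightarrow> real ^ 'n \<Rightarrow> real ^ 'n"
    where "A k x = (\<chi> a. if a = i then poly (g k) (x $ i) else 0)" for k x
  have "real_polynomial_function (\<lambda>x. A k x $ a)" for k a
    by (cases "a = i") (auto simp: A_def real_polynomial_function_poly_component)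
  moreover have "single_entry i (poly u (x $ i)) $ a $ b = (\<Sum>k<r. A k x $ a * A k x $ b)" for x a b
    by (auto simp: single_entry_def A_def g poly_sum power2_eq_square)
  ultimately show ?thesis unfolding sos_matrix_def by blast
qed

text \<open>The quadratic form is the sum of the squares of the products of \<open>v\<close> with
  the rows of the factor.\<close>

lemma sos_matrix_imp_psd:
  assumes "sos_matrix P"
  shows "psd_matrix_function P"
proof -
  obtain r :: nat and A where A: "\<And>x a b. P x $ a $ b = (\<Sum>k<r. A k x $ a * A k x $ b)"
    using assms unfolding sos_matrix_def by blast
  have "v \<bullet> (P x *v v) = (\<Sum>k<r. (A k x \<bullet> v)\<^sup>2)" for v x
  proof -
    have "v \<bullet> (P x *v v) = (\<Sum>a\<in>UNIV. \<Sum>b\<in>UNIV. \<Sum>k<r. (A k x $ a * v $ a) * (A k x $ b * v $ b))"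
      by (simp add: inner_vec_def matrix_vector_mult_def A sum_distrib_left sum_distrib_right mult_ac)
    also have "\<dots> = (\<Sum>k<r. \<Sum>a\<in>UNIV. \<Sum>b\<in>UNIV. (A k x $ a * v $ a) * (A k x $ b * v $ b))"
      by (subst sum.swap, subst sum.swap) (intro sum.cong refl sum.swap)
    finally show ?thesis by (simp add: inner_vec_def power2_eq_square sum_product)
  qed
  then show ?thesis
    by (auto simp: psd_matrix_function_def pos_semidef_def transpose_def vec_eq_iff A mult.commute
        intro!: sum_nonneg)
qed

section \<open>Convexity and its restriction to lines\<close>

lemma convex_on_real_second_derivative_nonneg:
  fixes g :: "real \<Rightarrow> real"
  assumes convex: "convex_on UNIV g"
    and g': "\<And>t. (g has_real_derivative g' t) (at t)"
    and g'': "(g' has_real_derivative d) (at t)"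
  shows "0 \<le> d"
proof -
  have above: "g y - g x \<ge> g' x * (y - x)" for x y
    using convex_on_imp_above_tangent[OF convex, of x y "g' x"] g' by simp
  have "mono_on UNIV g'"
  proof (rule mono_onI)
    fix x y :: real assume "x \<le> y"
    \<comment> \<open>Sum of the tangent inequalities at \<open>x\<close> and at
      \<open>y\<close>.\<close>
    have "0 \<le> (g' y - g' x) * (y - x)" using above[of x y] above[of y x] by (simp add: algebra_simps)
    with \<open>x \<le> y\<close> show "g' x \<le> g' y" by (cases "x = y") (auto simp: zero_le_mult_iff)
  qed
  then show ?thesis using mono_on_imp_deriv_nonneg g'' by fastforce
qed

lemma convex_on_lines_imp_convex_on:
  fixes p :: "'a::real_vector \<Rightarrow> real"
  assumes "\<And>x v. convex_on UNIV (\<lambda>t. p (x + t *\<^sub>R v))"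
  shows "convex_on UNIV p"
proof (rule convex_onI)
  fix t x y assume t: "0 < t" "t < (1::real)"
  have "p (x + ((1 - t) *\<^sub>R 0 + t *\<^sub>R 1) *\<^sub>R (y - x)) \<le>
      (1 - t) * p (x + 0 *\<^sub>R (y - x)) + t * p (x + 1 *\<^sub>R (y - x))"
    by (rule convex_onD[OF assms]) (use t in auto)
  then show "p ((1 - t) *\<^sub>R x + t *\<^sub>R y) \<le> (1 - t) * p x + t * p y"
    by (simp add: algebra_simps)
qed simp

lemma convex_on_imp_convex_on_line:
  fixes p :: "'a::real_vector \<Rightarrow> real"
  assumes "convex_on UNIV p"
  shows "convex_on UNIV (\<lambda>t. p (x + t *\<^sub>R v))"
proof (rule convex_onI)
  fix t a b assume t: "0 < t" "t < (1::real)"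
  have "p ((1 - t) *\<^sub>R (x + a *\<^sub>R v) + t *\<^sub>R (x + b *\<^sub>R v)) \<le>
      (1 - t) * p (x + a *\<^sub>R v) + t * p (x + b *\<^sub>R v)"
    by (rule convex_onD[OF assms]) (use t in auto)
  then show "p (x + ((1 - t) *\<^sub>R a + t *\<^sub>R b) *\<^sub>R v) \<le>
      (1 - t) * p (x + a *\<^sub>R v) + t * p (x + b *\<^sub>R v)"
    by (simp add: algebra_simps)
qed simp

section \<open>Derivatives and convexity of an SPQ polynomial\<close>

locale spq_polynomial =
  fixes u :: "'n::finite \<Rightarrow> real poly" and A :: "real ^ 'n ^ 'n" and b :: "real ^ 'n" and c :: real
    and p :: "real ^ 'n \<Rightarrow> real"
  assumes p: "\<And>x. p x = (\<Sum>i\<in>UNIV. poly (u i) (x $ i)) + x \<bullet> (A *v x) + b \<bullet> x + c"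
begin

text \<open>\<open>A\<close> need not be symmetric, so the quadratic part contributes
  \<open>A + transpose A\<close>.\<close>

definition gradient :: "real ^ 'n \<Rightarrow> real ^ 'n" where
  "gradient x = (\<chi> i. poly (pderiv (u i)) (x $ i)) + (A + transpose A) *v x + b"

definition hess :: "real ^ 'n \<Rightarrow> real ^ 'n ^ 'n" where
  "hess x = (\<Sum>i\<in>UNIV. single_entry i (poly (pderiv (pderiv (u i))) (x $ i))) + (A + transpose A)"

text \<open>Along a line \<open>p\<close> is an explicit polynomial in \<open>t\<close>. Directional
  derivatives give both the partial derivatives, for \<open>v\<close> an axis, and the convexity
  criterion.\<close>

lemma line_derivative:
  "((\<lambda>t. p (x + t *\<^sub>R v)) has_real_derivative v \<bullet> gradient (x + t *\<^sub>R v)) (at t)"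
proof -
  have T: "v \<bullet> (y v* A) = y \<bullet> (A *v v)" for y
    by (metis dot_lmul_matrix inner_commute)
  have "((\<lambda>t. (\<Sum>i\<in>UNIV. poly (u i) (x $ i + t * v $ i)) +
      (x \<bullet> (A *v x) + t * (x \<bullet> (A *v v)) + t * (v \<bullet> (A *v x)) + t\<^sup>2 * (v \<bullet> (A *v v))) +
      (b \<bullet> x + t * (b \<bullet> v)) + c) has_real_derivative
      (\<Sum>i\<in>UNIV. poly (pderiv (u i)) (x $ i + t * v $ i) * v $ i) +
      (x \<bullet> (A *v v) + v \<bullet> (A *v x) + 2 * t * (v \<bullet> (A *v v))) + b \<bullet> v) (at t)"
    by (auto intro!: derivative_eq_intros simp: sum.distrib mult.commute)
  moreover have "(\<lambda>t. p (x + t *\<^sub>R v)) = (\<lambda>t. (\<Sum>i\<in>UNIV. poly (u i) (x $ i + t * v $ i)) +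
      (x \<bullet> (A *v x) + t * (x \<bullet> (A *v v)) + t * (v \<bullet> (A *v x)) + t\<^sup>2 * (v \<bullet> (A *v v))) +
      (b \<bullet> x + t * (b \<bullet> v)) + c)"
    by (simp add: fun_eq_iff p matrix_vector_right_distrib matrix_vector_mult_scaleR inner_add_left
        inner_add_right power2_eq_square algebra_simps)
  moreover have "v \<bullet> gradient (x + t *\<^sub>R v) =
      (\<Sum>i\<in>UNIV. poly (pderiv (u i)) (x $ i + t * v $ i) * v $ i) +
      (x \<bullet> (A *v v) + v \<bullet> (A *v x) + 2 * t * (v \<bullet> (A *v v))) + b \<bullet> v"
  proof -
    have "v \<bullet> (\<chi> i. poly (pderiv (u i)) ((x + t *\<^sub>R v) $ i)) =
        (\<Sum>i\<in>UNIV. poly (pderiv (u i)) (x $ i + t * v $ i) * v $ i)"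
      by (simp add: inner_vec_def mult.commute)
    moreover have "v \<bullet> ((A + transpose A) *v (x + t *\<^sub>R v)) =
        x \<bullet> (A *v v) + v \<bullet> (A *v x) + 2 * t * (v \<bullet> (A *v v))"
      by (simp add: matrix_vector_mult_add_rdistrib T inner_add_right
          matrix_vector_right_distrib matrix_vector_mult_scaleR inner_commute algebra_simps)
    ultimately show ?thesis unfolding gradient_def by (simp add: inner_add_right inner_commute)
  qed
  ultimately show ?thesis by simp
qed

lemma sum_single_entry_mult:
  "((\<Sum>i\<in>UNIV. single_entry i (d i)) *v v) $ j = d j * v $ j"
proof -
  have *: "(\<Sum>i\<in>UNIV. single_entry i (d i) $ j $ k) = (if j = k then d j else 0)" for k
    by (cases "j = k") (auto simp: single_entry_def intro!: sum.neutral)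
  show ?thesis
    by (simp add: matrix_vector_mult_def * if_distribR if_distrib cong: if_cong)
qed

lemma gradient_line_derivative:
  "((\<lambda>t. gradient (x + t *\<^sub>R v) $ j) has_real_derivative (hess (x + t *\<^sub>R v) *v v) $ j) (at t)"
proof -
  let ?B = "A + transpose A"
  have "((\<lambda>t. poly (pderiv (u j)) (x $ j + t * v $ j) + ((?B *v x) $ j + t * (?B *v v) $ j) + b $ j)
     has_real_derivative poly (pderiv (pderiv (u j))) (x $ j + t * v $ j) * v $ j + (?B *v v) $ j) (at t)"
    by (auto intro!: derivative_eq_intros)
  moreover have "(\<lambda>t. gradient (x + t *\<^sub>R v) $ j) =
    (\<lambda>t. poly (pderiv (u j)) (x $ j + t * v $ j) + ((?B *v x) $ j + t * (?B *v v) $ j) + b $ j)"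
    by (simp add: fun_eq_iff gradient_def matrix_vector_right_distrib matrix_vector_mult_scaleR)
  moreover have "(hess (x + t *\<^sub>R v) *v v) $ j =
    poly (pderiv (pderiv (u j))) (x $ j + t * v $ j) * v $ j + (?B *v v) $ j"
    unfolding hess_def matrix_vector_mult_add_rdistrib[of _ ?B] vector_add_component[of _ "?B *v v"]
      sum_single_entry_mult by simp
  ultimately show ?thesis by simp
qed

lemma second_line_derivative:
  "((\<lambda>t. v \<bullet> gradient (x + t *\<^sub>R v)) has_real_derivative v \<bullet> (hess (x + t *\<^sub>R v) *v v)) (at t)"
  unfolding inner_vec_def inner_real_def
  by (intro DERIV_sum DERIV_cmult gradient_line_derivative)

lemma hess_sym: "transpose (hess x) = hess x"
  by (auto simp: hess_def transpose_def vec_eq_iff single_entry_def intro!: sum.cong)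

lemma hessian_eq: "hessian p x = hess x"
proof -
  have 1: "partial_deriv j p = (\<lambda>y. gradient y $ j)" for j
    using DERIV_imp_deriv[OF line_derivative[of _ "axis j 1" 0]]
    by (auto simp: partial_deriv_def inner_axis')
  have 2: "partial_deriv i (\<lambda>y. gradient y $ j) x = hess x $ j $ i" for i j
    using DERIV_imp_deriv[OF gradient_line_derivative[of x "axis i 1" j 0]]
    by (simp add: partial_deriv_def matrix_vector_mult_basis column_def)
  \<comment> \<open>Differentiating component \<open>j\<close> of the gradient in direction
    \<open>i\<close> yields entry \<open>(j, i)\<close>, while \<open>hessian\<close> has it at
    \<open>(i, j)\<close>.\<close>
  have "hess x $ j $ i = hess x $ i $ j" for i j
    using arg_cong[OF hess_sym[of x], of "\<lambda>M. M $ i $ j"] by (simp add: transpose_def)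
  then show ?thesis by (simp add: hessian_def vec_eq_iff 1 2)
qed

text \<open>Convexity is convexity on every line, where the second derivative is the quadratic form
  of \<open>hess\<close> at the direction.\<close>

lemma convex_iff_hess_psd: "convex_on UNIV p \<longleftrightarrow> (\<forall>x. pos_semidef (hess x))"
proof
  assume "convex_on UNIV p"
  then have "0 \<le> v \<bullet> (hess (x + 0 *\<^sub>R v) *v v)" for x v
    using convex_on_real_second_derivative_nonneg[OF convex_on_imp_convex_on_line line_derivative
        second_line_derivative] by blast
  then show "\<forall>x. pos_semidef (hess x)" by (simp add: pos_semidef_def hess_sym)
next
  assume psd: "\<forall>x. pos_semidef (hess x)"
  show "convex_on UNIV p"
  proof (rule convex_on_lines_imp_convex_on)
    show "convex_on UNIV (\<lambda>t. p (x + t *\<^sub>R v))" for x v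
      by (rule f''_ge0_imp_convex[OF convex_UNIV line_derivative second_line_derivative])
        (use psd in \<open>simp add: pos_semidef_def\<close>)
  qed
qed

lemma real_polynomial_function_p: "real_polynomial_function p"
proof -
  have i: "real_polynomial_function (\<lambda>x :: real ^ 'n. x $ i)" for i
    by (intro real_polynomial_function.intros(1) bounded_linear_vec_nth)
  have "real_polynomial_function (\<lambda>x. (\<Sum>i\<in>UNIV. poly (u i) (x $ i)) +
      (\<Sum>i\<in>UNIV. x $ i * (\<Sum>j\<in>UNIV. A $ i $ j * x $ j)) + (\<Sum>i\<in>UNIV. b $ i * x $ i) + c)"
    by (intro real_polynomial_function.intros(2-) real_polynomial_function_sum i
        real_polynomial_function_poly_component finite)
  moreover have "p = (\<lambda>x. (\<Sum>i\<in>UNIV. poly (u i) (x $ i)) +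
      (\<Sum>i\<in>UNIV. x $ i * (\<Sum>j\<in>UNIV. A $ i $ j * x $ j)) + (\<Sum>i\<in>UNIV. b $ i * x $ i) + c)"
    by (simp add: fun_eq_iff p inner_vec_def matrix_vector_mult_def)
  ultimately show ?thesis by simp
qed

lemma hess_decomposition:
  assumes psd: "\<And>x. pos_semidef (hess x)"
  obtains w Q where "\<And>i t. 0 \<le> poly (w i) t" "pos_semidef Q"
    "\<And>x. hess x = (\<Sum>i\<in>UNIV. single_entry i (poly (w i) (x $ i))) + Q"
proof -
  let ?d = "\<lambda>i. pderiv (pderiv (u i))"
  have diag: "hess x $ i $ i = poly (?d i) (x $ i) + 2 * A $ i $ i" for x i
    by (simp add: hess_def single_entry_def transpose_def)
  have "\<exists>a. \<forall>t. poly (?d i) a \<le> poly (?d i) t" for i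
  proof -
    \<comment> \<open>A diagonal entry depends on one coordinate only, so any point with coordinate
      \<open>t\<close> there will do.\<close>
    have "- 2 * A $ i $ i \<le> poly (?d i) t" for t
      using pos_semidef_diag_nonneg[OF psd, of "\<chi> j. t" i] diag[of "\<chi> j. t" i] by simp
    then show ?thesis using real_poly_bounded_below_attains_min by metis
  qed
  then obtain a where a: "\<And>i t. poly (?d i) (a i) \<le> poly (?d i) t" by metis
  show thesis
  \<comment> \<open>Witnesses: \<open>w i\<close> is the second derivative of \<open>u i\<close>
    minus its minimum, and \<open>Q\<close> is \<open>hess\<close> at the point of the minimizers
    \<open>a i\<close>.\<close>
  proof
    show "0 \<le> poly (?d i - [:poly (?d i) (a i):]) t" for i t using a by simp
    show "pos_semidef (hess (\<chi> i. a i))" by (rule psd)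
    \<comment> \<open>The subtracted minima cancel against the diagonal part of
      \<open>Q\<close>.\<close>
    have "single_entry i (s - t) + single_entry i t = single_entry i s" for s t :: real and i :: 'n
      by (simp add: single_entry_def vec_eq_iff)
    then show "hess x = (\<Sum>i\<in>UNIV. single_entry i (poly (?d i - [:poly (?d i) (a i):]) (x $ i)))
      + hess (\<chi> i. a i)" for x
      by (simp add: hess_def add.assoc[symmetric] sum.distrib[symmetric] del: sum.distrib)
  qed
qed

end

section \<open>Decomposition of the Hessian and sos-convexity\<close>

lemma spqE:
  assumes "spq p"
  obtains u A b c where "spq_polynomial u A b c p"
proof -
  obtain s q where "separable s" "quadratic q" and p: "\<And>x. p x = s x + q x"
    using assms by (auto simp: spq_def)
  then obtain u A b c where "\<And>x. s x = (\<Sum>i\<in>UNIV. poly (u i) (x $ i))"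
    "\<And>x. q x = x \<bullet> (A *v x) + b \<bullet> x + c"
    unfolding separable_def quadratic_def by metis
  with p have "spq_polynomial u A b c p" by unfold_locales simp
  then show ?thesis using that by blast
qed

theorem theorem5p1:
  fixes p :: "real ^ 'n \<Rightarrow> real"
  assumes "spq p"
  shows "(convex_on UNIV p \<longrightarrow>
            (\<exists>(N :: nat) (P :: nat \<Rightarrow> real ^ 'n \<Rightarrow> real ^ 'n ^ 'n).
               (\<forall>k<N. univariate_polynomial_matrix (P k) \<and> psd_matrix_function (P k)) \<and>
               (\<forall>x. hessian p x = (\<Sum>k<N. P k x)))) \<and>
         (convex_on UNIV p \<longleftrightarrow> sos_convex p)"
proof -
  obtain u A b c where "spq_polynomial u A b c p" using spqE[OF assms] .
  then interpret spq_polynomial u A b c p .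
  have main: "(\<exists>(N :: nat) (P :: nat \<Rightarrow> real ^ 'n \<Rightarrow> real ^ 'n ^ 'n).
               (\<forall>k<N. univariate_polynomial_matrix (P k) \<and> psd_matrix_function (P k)) \<and>
               (\<forall>x. hessian p x = (\<Sum>k<N. P k x))) \<and> sos_convex p"
    if convex: "convex_on UNIV p"
  proof -
    from convex have "\<And>x. pos_semidef (hess x)" by (simp add: convex_iff_hess_psd)
    then obtain w Q where w: "\<And>i t. 0 \<le> poly (w i) t" and Q: "pos_semidef Q"
      and dec: "\<And>x. hess x = (\<Sum>i\<in>UNIV. single_entry i (poly (w i) (x $ i))) + Q"
      using hess_decomposition by blast
    \<comment> \<open>Numbers the coordinates, since the summands are indexed by naturals.\<close>
    obtain e :: "nat \<Rightarrow> 'n" where "bij_betw e {0..<CARD('n)} UNIV"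
      using ex_bij_betw_nat_finite[OF finite] by blast
    then have e: "bij_betw e {..<CARD('n)} UNIV" by (simp add: lessThan_atLeast0)
    \<comment> \<open>One summand per variable; the constant \<open>Q\<close> takes index
      \<open>CARD('n)\<close>, so there are \<open>Suc CARD('n)\<close> summands.\<close>
    define P where "P k x = (if k < CARD('n) then single_entry (e k) (poly (w (e k)) (x $ e k)) else Q)"
      for k and x :: "real ^ 'n"
    have "univariate_polynomial_matrix (P k) \<and> psd_matrix_function (P k)" for k
      using univariate_polynomial_matrix_single_entry[of "e k" "w (e k)"]
        univariate_polynomial_matrix_const[of Q] w Q
      by (cases "k < CARD('n)") (auto simp: P_def[abs_def] psd_matrix_function_def pos_semidef_single_entry)
    moreover have "hessian p x = (\<Sum>k<Suc CARD('n). P k x)" for x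
      using sum.reindex_bij_betw[OF e, of "\<lambda>i. single_entry i (poly (w i) (x $ i))"]
      by (simp add: hessian_eq dec P_def)
    moreover have "sos_convex p"
      unfolding sos_convex_def hessian_eq[abs_def] dec[abs_def]
      by (intro conjI real_polynomial_function_p sos_matrix_add sos_matrix_sum finite
          sos_matrix_single_entry sos_matrix_const w Q)
    ultimately show ?thesis by blast
  qed
  \<comment> \<open>Conversely, an sos Hessian is positive semidefinite everywhere.\<close>
  have "convex_on UNIV p" if "sos_convex p"
    using sos_matrix_imp_psd[of "hessian p"] that
    by (simp add: convex_iff_hess_psd sos_convex_def psd_matrix_function_def hessian_eq)
  with main show ?thesis by blast
qed

end
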